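(* The polymorphism clone $\operatorname{Pol}(V;E)$ of the random graph $(V;E)$ has automatic homeomorphicity.
   Context: The random graph $(V;E)$ is the Fraïssé limit of the class of all finite undirected loopless graphs (the unique countable homogeneous graph embedding every finite graph). $\operatorname{Pol}(V;E)$ is the set of all polymorphisms, i.e. all homomorphisms $(V;E)^n\to(V;E)$, $n\ge1$: functions $f\colon V^n\to V$ such that $E(u_i,v_i)$ for all $i$ implies $E(f(u_1,\dots,u_n),f(v_1,\dots,v_n))$. For a countably infinite set $D$, $\mathbf O$ denotes the clone of all operations $D^n\to D$, $n\ge1$, with the topology of pointwise convergence ($D$ discrete; for each $n$ the $n$-ary operations form a clopen set). A closed subclone of $\mathbf O$ is a closed subset (on some countably infinite domain) containing all projections $\pi^n_k(x_1,\dots,x_n)=x_k$ and closed under composition $f(g_1,\dots,g_n)$, with the subspace topology. A clone isomorphism is a bijection between function clones preserving arities, projections and composition. A closed subclone $\mathbf C$ of $\mathbf O$ has automatic homeomorphicity if every clone isomorphism between $\mathbf C$ and a closed subclone of $\mathbf O$ is a homeomorphism. *)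

theory Defs
  imports "HOL-Analysis.Analysis"
begin

section \<open>Operation clones on a set\<close>

text \<open>An operation is a pair of its arity and its function. Tuples are lists, and the function
  is extensional (\<^const>\<open>undefined\<close> off the tuples of the right length over the domain), so that
  equality of pairs is equality of operations. The arity is recorded because an extensional
  function alone need not determine it.\<close>

type_synonym 'a operation = "nat \<times> ('a list \<Rightarrow> 'a)"

definition tuples :: "'a set \<Rightarrow> nat \<Rightarrow> 'a list set" where
  "tuples D n = {xs. set xs \<subseteq> D \<and> length xs = n}"

definition all_ops :: "'a set \<Rightarrow> 'a operation set" where
  "all_ops D = (SIGMA n:{1..}. tuples D n \<rightarrow>\<^sub>E D)"

definition op_topology :: "'a set \<Rightarrow> 'a operation topology" where
  "op_topology D =
     sum_topology (\<lambda>n. product_topology (\<lambda>_. discrete_topology D) (tuples D n)) {1..}"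

lemma topspace_op_topology: "topspace (op_topology D) = all_ops D"
  by (simp add: op_topology_def all_ops_def o_def)

text \<open>Positions are counted from 0, so the projections of arity \<open>n\<close> are those with \<open>k < n\<close>.\<close>

definition proj_op :: "'a set \<Rightarrow> nat \<Rightarrow> nat \<Rightarrow> 'a operation" where
  "proj_op D n k = (n, \<lambda>xs\<in>tuples D n. xs ! k)"

text \<open>\<open>comp_op D m f [g\<^sub>1, \<dots>, g\<^sub>n]\<close> is meant for \<open>f\<close> of arity \<open>n\<close> and all \<open>g\<^sub>i\<close> of arity \<open>m\<close>.\<close>

definition comp_op :: "'a set \<Rightarrow> nat \<Rightarrow> 'a operation \<Rightarrow> 'a operation list \<Rightarrow> 'a operation" where
  "comp_op D m f gs = (m, \<lambda>xs\<in>tuples D m. snd f (map (\<lambda>g. snd g xs) gs))"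

definition composable :: "'a operation set \<Rightarrow> nat \<Rightarrow> 'a operation \<Rightarrow> 'a operation list \<Rightarrow> bool" where
  "composable C m f gs \<longleftrightarrow>
     f \<in> C \<and> set gs \<subseteq> C \<and> length gs = fst f \<and> (\<forall>g\<in>set gs. fst g = m)"

definition function_clone :: "'a set \<Rightarrow> 'a operation set \<Rightarrow> bool" where
  "function_clone D C \<longleftrightarrow>
     C \<subseteq> all_ops D \<and>
     (\<forall>n\<ge>1. \<forall>k<n. proj_op D n k \<in> C) \<and>
     (\<forall>m f gs. composable C m f gs \<longrightarrow> comp_op D m f gs \<in> C)"

definition closed_subclone :: "'a set \<Rightarrow> 'a operation set \<Rightarrow> bool" where
  "closed_subclone D C \<longleftrightarrow>
     countable D \<and> infinite D \<and> function_clone D C \<and> closedin (op_topology D) C"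

definition clone_iso ::
  "'a set \<Rightarrow> 'a operation set \<Rightarrow> 'b set \<Rightarrow> 'b operation set \<Rightarrow> ('a operation \<Rightarrow> 'b operation) \<Rightarrow> bool"
where
  "clone_iso D C D' C' \<phi> \<longleftrightarrow>
     bij_betw \<phi> C C' \<and>
     (\<forall>f\<in>C. fst (\<phi> f) = fst f) \<and>
     (\<forall>n\<ge>1. \<forall>k<n. \<phi> (proj_op D n k) = proj_op D' n k) \<and>
     (\<forall>m f gs. composable C m f gs \<longrightarrow>
        \<phi> (comp_op D m f gs) = comp_op D' m (\<phi> f) (map \<phi> gs))"

text \<open>A definition cannot quantify over types, so the type containing the domain of the other
  clone is a parameter; statements leave it as a free type variable. The domain itself ranges
  over all countably infinite subsets of that type.\<close>

definition automatic_homeomorphicity :: "'b itself \<Rightarrow> 'a set \<Rightarrow> 'a operation set \<Rightarrow> bool" where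
  "automatic_homeomorphicity _ D C \<longleftrightarrow>
     closed_subclone D C \<and>
     (\<forall>(D' :: 'b set) C' \<phi>. closed_subclone D' C' \<longrightarrow> clone_iso D C D' C' \<phi> \<longrightarrow>
        homeomorphic_map (subtopology (op_topology D) C) (subtopology (op_topology D') C') \<phi>)"

section \<open>The random graph and its polymorphisms\<close>

definition undirected_graph :: "'v set \<Rightarrow> 'v rel \<Rightarrow> bool" where
  "undirected_graph V E \<longleftrightarrow> E \<subseteq> V \<times> V \<and> sym E \<and> irrefl E"

definition induced :: "'v rel \<Rightarrow> 'v set \<Rightarrow> 'v rel" where
  "induced E A = E \<inter> A \<times> A"

definition graph_iso :: "'v set \<Rightarrow> 'v rel \<Rightarrow> 'w set \<Rightarrow> 'w rel \<Rightarrow> ('v \<Rightarrow> 'w) \<Rightarrow> bool" where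
  "graph_iso V E W F h \<longleftrightarrow>
     bij_betw h V W \<and> (\<forall>x\<in>V. \<forall>y\<in>V. (x, y) \<in> E \<longleftrightarrow> (h x, h y) \<in> F)"

definition homogeneous_graph :: "'v set \<Rightarrow> 'v rel \<Rightarrow> bool" where
  "homogeneous_graph V E \<longleftrightarrow>
     (\<forall>A B h. finite A \<and> A \<subseteq> V \<and> B \<subseteq> V \<and> graph_iso A (induced E A) B (induced E B) h \<longrightarrow>
        (\<exists>g. graph_iso V E V E g \<and> (\<forall>x\<in>A. g x = h x)))"

definition graph_embeds :: "'w set \<Rightarrow> 'w rel \<Rightarrow> 'v set \<Rightarrow> 'v rel \<Rightarrow> bool" where
  "graph_embeds W F V E \<longleftrightarrow> (\<exists>A h. A \<subseteq> V \<and> graph_iso W F A (induced E A) h)"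

text \<open>Finite graphs are taken up to isomorphism, so vertex sets in \<^typ>\<open>nat\<close> suffice.\<close>

definition random_graph :: "'v set \<Rightarrow> 'v rel \<Rightarrow> bool" where
  "random_graph V E \<longleftrightarrow>
     undirected_graph V E \<and> countable V \<and> homogeneous_graph V E \<and>
     (\<forall>(W :: nat set) F. finite W \<and> undirected_graph W F \<longrightarrow> graph_embeds W F V E)"

definition Pol :: "'v set \<Rightarrow> 'v rel \<Rightarrow> 'v operation set" where
  "Pol V E = {(n, f) \<in> all_ops V. \<forall>us\<in>tuples V n. \<forall>vs\<in>tuples V n.
     list_all2 (\<lambda>u v. (u, v) \<in> E) us vs \<longrightarrow> (f us, f vs) \<in> E}"

end

theory Submission
  imports Defs
begin

text \<open>Let \<open>\<phi>\<close> be a clone isomorphism from \<open>Pol(V;E)\<close> onto a clone on a countable set \<open>D'\<close>. The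
  topologies of \<open>Pol(V;E)\<close> and of its image are given by evaluation at tuples, so two things are
  needed: the value of \<open>\<phi>(f)\<close> at a tuple over \<open>D'\<close> depends only on finitely many values of \<open>f\<close>,
  and conversely.

  Both rest on one property of the random graph (\<open>free_embedding\<close>): every countable graph \<open>W\<close> embeds
  in \<open>V\<close> in such a way that every homomorphism from \<open>W\<close> to \<open>V\<close> extends to an endomorphism of
  \<open>V\<close>. One places \<open>W\<close> so that each vertex outside it has only finitely many neighbours in it; the
  remaining vertices can then be mapped one after the other, because any finite set of vertices
  has a common neighbour. The \<open>n\<close>-ary polymorphisms are the homomorphisms to \<open>V\<close> from the countable
  graph \<open>V\<^sup>n\<close>, so the property makes it possible to prescribe the behaviour of polymorphisms
  by drawing a suitable countable graph.

  Continuity of \<open>\<phi>\<close>. Blow up \<open>V\<^sup>n\<close> along a binary tree to obtain, for each of the uncountably many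
  sets \<open>X\<close> of natural numbers, an \<open>n\<close>-ary polymorphism \<open>a\<^sub>X\<close>, with the following
  freeness (\<open>cantor_family\<close>): for \<open>X \<noteq> Y\<close> there is a finite set of tuples such that any two
  polymorphisms \<open>s\<close>, \<open>t\<close> which agree on it are of the form \<open>s = h a\<^sub>X\<close>, \<open>t = h a\<^sub>Y\<close>
  for a single endomorphism \<open>h\<close>. Let \<open>d\<close> be an \<open>n\<close>-tuple over \<open>D'\<close>. Since \<open>D'\<close> is countable,
  \<open>\<phi>(a\<^sub>X)(d) = \<phi>(a\<^sub>Y)(d)\<close> for some \<open>X \<noteq> Y\<close>. Applying \<open>\<phi>(h)\<close> to both sides gives
  \<open>\<phi>(s)(d) = \<phi>(t)(d)\<close> whenever \<open>s\<close> and \<open>t\<close> agree on that finite set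
  (\<open>locally_constant_evaluation\<close>). This pigeonhole argument takes the place of a small index
  property of the automorphism group.

  Continuity of the inverse. Let \<open>f\<close> be \<open>n\<close>-ary and \<open>b = f(a)\<close>. Doubling the vertex \<open>(b, a)\<close> of
  \<open>V\<^sup>n\<^sup>+\<^sup>1\<close> gives two polymorphisms \<open>u\<close>, \<open>v\<close> which differ there and nowhere else. Then
  \<open>g(a) \<noteq> b\<close> is equivalent to the equation \<open>u(g, \<pi>\<^sub>1, \<dots>, \<pi>\<^sub>n) = v(g, \<pi>\<^sub>1, \<dots>, \<pi>\<^sub>n)\<close>, which \<open>\<phi>\<close> preserves
  and reflects. The equation fails for \<open>f\<close>, hence its image fails at some tuple \<open>d\<close>, and whether
  it fails at \<open>d\<close> depends on \<open>\<phi>(g)(d)\<close> only (\<open>value_detected_at_one_tuple\<close>).\<close>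

section \<open>Pointwise convergence\<close>

lemma all_opsD:
  assumes "C \<subseteq> all_ops D" "f \<in> C"
  shows "fst f \<ge> 1" "snd f \<in> tuples D (fst f) \<rightarrow>\<^sub>E D"
proof -
  have "f \<in> all_ops D" using assms by blast
  then show "fst f \<ge> 1" "snd f \<in> tuples D (fst f) \<rightarrow>\<^sub>E D"
    unfolding all_ops_def mem_Sigma_iff by auto
qed

text \<open>Reduces every topological question below to agreement of operations on finite sets of
  tuples. The basic neighbourhoods of \<open>f\<close> fix its arity as well, since each arity is a clopen
  summand of the topology.\<close>

lemma openin_clone_iff:
  assumes "C \<subseteq> all_ops D"
  shows "openin (subtopology (op_topology D) C) U \<longleftrightarrow>
    U \<subseteq> C \<and> (\<forall>f\<in>U. \<exists>F. finite F \<and> F \<subseteq> tuples D (fst f) \<and>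
      (\<forall>g\<in>C. fst g = fst f \<longrightarrow> (\<forall>x\<in>F. snd g x = snd f x) \<longrightarrow> g \<in> U))"
    (is "?L \<longleftrightarrow> U \<subseteq> C \<and> ?R U")
proof
  assume ?L
  then obtain T where T: "openin (op_topology D) T" "U = T \<inter> C"
    by (auto simp: openin_subtopology)
  have "?R U"
  proof
    fix f assume f: "f \<in> U"
    obtain n f' where ff: "f = (n, f')" by force
    have "n \<ge> 1" using f T assms ff by (auto simp: all_ops_def)
    then have "openin (product_topology (\<lambda>_. discrete_topology D) (tuples D n)) {x. (n, x) \<in> T}"
      using T(1) by (auto simp: op_topology_def openin_sum_topology)
    moreover have "f' \<in> {x. (n, x) \<in> T}" using f ff T by auto
    ultimately obtain W where W: "finite {i \<in> tuples D n. W i \<noteq> D}"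
      "\<forall>i\<in>tuples D n. openin (discrete_topology D) (W i)"
      "f' \<in> Pi\<^sub>E (tuples D n) W" "Pi\<^sub>E (tuples D n) W \<subseteq> {x. (n, x) \<in> T}"
      unfolding openin_product_topology_alt by (auto 4 3)
    define F where "F = {i \<in> tuples D n. W i \<noteq> D}"
    have "g \<in> U" if g: "g \<in> C" "fst g = n" "\<forall>x\<in>F. snd g x = f' x" for g
    proof -
      have gp: "snd g \<in> tuples D n \<rightarrow>\<^sub>E D" using all_opsD(2)[OF assms g(1)] g(2) by simp
      have "snd g \<in> Pi\<^sub>E (tuples D n) W"
      proof (rule PiE_I)
        fix x assume x: "x \<in> tuples D n"
        show "snd g x \<in> W x"
        proof (cases "x \<in> F")
          case True
          then show ?thesis using g(3) W(3) x by (metis PiE_mem)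
        next
          case False
          then have "W x = D" using x by (simp add: F_def)
          then show ?thesis using gp x by (metis PiE_mem)
        qed
      qed (use gp in \<open>auto simp: PiE_def extensional_def\<close>)
      then have "(n, snd g) \<in> T" using W(4) by auto
      then show ?thesis using g T(2) by (cases g) auto
    qed
    then show "\<exists>F. finite F \<and> F \<subseteq> tuples D (fst f) \<and>
      (\<forall>g\<in>C. fst g = fst f \<longrightarrow> (\<forall>x\<in>F. snd g x = snd f x) \<longrightarrow> g \<in> U)"
      using W(1) by (intro exI[of _ F]) (auto simp: ff F_def)
  qed
  then show "U \<subseteq> C \<and> ?R U" using T by auto
next
  assume R: "U \<subseteq> C \<and> ?R U"
  then obtain F where F: "\<And>f. f \<in> U \<Longrightarrow> finite (F f)" "\<And>f. f \<in> U \<Longrightarrow> F f \<subseteq> tuples D (fst f)"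
    "\<And>f g. f \<in> U \<Longrightarrow> g \<in> C \<Longrightarrow> fst g = fst f \<Longrightarrow> (\<forall>x\<in>F f. snd g x = snd f x) \<Longrightarrow> g \<in> U"
    by metis
  define B where "B f = {g \<in> all_ops D. fst g = fst f \<and> (\<forall>x\<in>F f. snd g x = snd f x)}" for f
  have "openin (op_topology D) (B f)" if f: "f \<in> U" for f
  proof -
    have "f \<in> C" using f R by blast
    note fD = all_opsD[OF assms this]
    define W where "W x = (if x \<in> F f then {snd f x} else D)" for x
    have slice: "{x. (n, x) \<in> B f} = (if n = fst f then Pi\<^sub>E (tuples D n) W else {})" for n
    proof (cases "n = fst f")
      case True
      have "x \<in> Pi\<^sub>E (tuples D n) W \<longleftrightarrow> x \<in> tuples D n \<rightarrow>\<^sub>E D \<and> (\<forall>y\<in>F f. x y = snd f y)" for x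
        using F(2)[OF f] fD(2) True by (auto simp: PiE_iff W_def split: if_splits)
      then show ?thesis using True fD by (auto simp: B_def all_ops_def)
    qed (auto simp: B_def)
    have "openin (product_topology (\<lambda>_. discrete_topology D) (tuples D (fst f)))
            (Pi\<^sub>E (tuples D (fst f)) W)"
    proof -
      have "finite {i \<in> tuples D (fst f). W i \<noteq> topspace (discrete_topology D)}"
        by (rule finite_subset[OF _ F(1)[OF f]]) (auto simp: W_def)
      moreover have "openin (discrete_topology D) (W x)" if "x \<in> tuples D (fst f)" for x
        using fD(2) that by (auto simp: W_def)
      ultimately show ?thesis by (simp add: openin_PiE_gen)
    qed
    then show ?thesis
      by (auto simp: op_topology_def openin_sum_topology slice) (auto simp: B_def all_ops_def)
  qed
  then have "openin (op_topology D) (\<Union>f\<in>U. B f)" by auto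
  moreover have "U = (\<Union>f\<in>U. B f) \<inter> C"
    using R F(3) assms by (auto simp: B_def)
  ultimately show ?L by (auto simp: openin_subtopology)
qed

lemma continuous_map_clone:
  assumes C: "C \<subseteq> all_ops D" and C': "C' \<subseteq> all_ops D'"
    and \<phi>: "\<phi> ` C \<subseteq> C'" and ar: "\<And>f. f \<in> C \<Longrightarrow> fst (\<phi> f) = fst f"
    and loc: "\<And>f d. f \<in> C \<Longrightarrow> d \<in> tuples D' (fst f) \<Longrightarrow>
      \<exists>F. finite F \<and> F \<subseteq> tuples D (fst f) \<and>
        (\<forall>g\<in>C. fst g = fst f \<longrightarrow> (\<forall>x\<in>F. snd g x = snd f x) \<longrightarrow> snd (\<phi> g) d = snd (\<phi> f) d)"
  shows "continuous_map (subtopology (op_topology D) C) (subtopology (op_topology D') C') \<phi>"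
  unfolding continuous_map_def
proof (intro conjI allI impI)
  show "\<phi> \<in> topspace (subtopology (op_topology D) C) \<rightarrow> topspace (subtopology (op_topology D') C')"
    using \<phi> C C' by (auto simp: topspace_op_topology)
  fix U assume "openin (subtopology (op_topology D') C') U"
  then have U: "U \<subseteq> C'" "\<forall>f\<in>U. \<exists>F. finite F \<and> F \<subseteq> tuples D' (fst f) \<and>
      (\<forall>g\<in>C'. fst g = fst f \<longrightarrow> (\<forall>x\<in>F. snd g x = snd f x) \<longrightarrow> g \<in> U)"
    unfolding openin_clone_iff[OF C'] by (rule conjunct1, rule conjunct2)
  have "\<exists>G. finite G \<and> G \<subseteq> tuples D (fst f) \<and>
      (\<forall>g\<in>C. fst g = fst f \<longrightarrow> (\<forall>x\<in>G. snd g x = snd f x) \<longrightarrow> g \<in> C \<and> \<phi> g \<in> U)"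
    if f: "f \<in> C" "\<phi> f \<in> U" for f
  proof -
    obtain F where F: "finite F" "F \<subseteq> tuples D' (fst f)"
      "\<forall>g\<in>C'. fst g = fst f \<longrightarrow> (\<forall>x\<in>F. snd g x = snd (\<phi> f) x) \<longrightarrow> g \<in> U"
      using bspec[OF U(2) f(2)] unfolding ar[OF f(1)] by blast
    have "\<forall>d\<in>F. \<exists>G. finite G \<and> G \<subseteq> tuples D (fst f) \<and> (\<forall>g\<in>C. fst g = fst f \<longrightarrow>
        (\<forall>x\<in>G. snd g x = snd f x) \<longrightarrow> snd (\<phi> g) d = snd (\<phi> f) d)"
      using loc[OF f(1)] F(2) by blast
    from bchoice[OF this] obtain G where
      G: "\<forall>d\<in>F. finite (G d) \<and> G d \<subseteq> tuples D (fst f) \<and> (\<forall>g\<in>C. fst g = fst f \<longrightarrow>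
        (\<forall>x\<in>G d. snd g x = snd f x) \<longrightarrow> snd (\<phi> g) d = snd (\<phi> f) d)" ..
    have "\<phi> g \<in> U" if g: "g \<in> C" "fst g = fst f" "\<forall>x\<in>\<Union>(G ` F). snd g x = snd f x" for g
    proof -
      have "snd (\<phi> g) d = snd (\<phi> f) d" if "d \<in> F" for d using G g that by blast
      moreover have "\<phi> g \<in> C'" "fst (\<phi> g) = fst f" using g \<phi> ar by auto
      ultimately show ?thesis using F(3) by blast
    qed
    then show ?thesis using F(1) G by (intro exI[of _ "\<Union>(G ` F)"]) blast
  qed
  then have "openin (subtopology (op_topology D) C) {x \<in> C. \<phi> x \<in> U}"
    by (subst openin_clone_iff[OF C]) auto
  moreover have "{x \<in> topspace (subtopology (op_topology D) C). \<phi> x \<in> U} = {x \<in> C. \<phi> x \<in> U}"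
    using C by (auto simp: topspace_op_topology)
  ultimately show "openin (subtopology (op_topology D) C)
      {x \<in> topspace (subtopology (op_topology D) C). \<phi> x \<in> U}" by simp
qed

lemma clone_iso_comp:
  assumes "clone_iso D C D' C' \<phi>" "composable C m f gs"
  shows "\<phi> (comp_op D m f gs) = comp_op D' m (\<phi> f) (map \<phi> gs)"
  using assms unfolding clone_iso_def by blast

section \<open>Homomorphisms into the random graph\<close>

definition graph_hom :: "'p set \<Rightarrow> 'p rel \<Rightarrow> 'v set \<Rightarrow> 'v rel \<Rightarrow> ('p \<Rightarrow> 'v) \<Rightarrow> bool" where
  "graph_hom P R V E h \<longleftrightarrow> h ` P \<subseteq> V \<and> (\<forall>(x, y)\<in>R. (h x, h y) \<in> E)"

lemma graph_homD:
  assumes "graph_hom P R V E h"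
  shows "x \<in> P \<Longrightarrow> h x \<in> V" "(x, y) \<in> R \<Longrightarrow> (h x, h y) \<in> E"
  using assms by (auto simp: graph_hom_def)

lemma graph_hom_comp:
  assumes "graph_hom P R Q S f" "graph_hom Q S V E g"
  shows "graph_hom P R V E (\<lambda>x. g (f x))"
  using assms unfolding graph_hom_def by fast

lemma graph_hom_cong:
  assumes "R \<subseteq> P \<times> P" "\<And>x. x \<in> P \<Longrightarrow> f x = g x"
  shows "graph_hom P R V E f \<longleftrightarrow> graph_hom P R V E g"
proof -
  have "(\<forall>(x, y)\<in>R. (f x, f y) \<in> E) \<longleftrightarrow> (\<forall>(x, y)\<in>R. (g x, g y) \<in> E)"
    using assms by (intro ball_cong) auto
  moreover have "f ` P = g ` P" using assms(2) by (rule image_cong[OF refl])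
  ultimately show ?thesis by (simp add: graph_hom_def)
qed

locale rado_graph =
  fixes V :: "'v set" and E :: "'v rel"
  assumes random_graph: "random_graph V E"
begin

lemma edges: "E \<subseteq> V \<times> V" "sym E" "irrefl E" "countable V"
  using random_graph by (auto simp: random_graph_def undirected_graph_def)

text \<open>By universality the finite graph on \<open>A \<union> B\<close> together with a new vertex adjacent to exactly
  \<open>A\<close> has a copy in \<open>V\<close>; by homogeneity the copy can be moved so that it lies on \<open>A \<union> B\<close> itself.\<close>

lemma extension_property:
  assumes "finite A" "finite B" "A \<subseteq> V" "B \<subseteq> V" "A \<inter> B = {}"
  obtains w where "w \<in> V" "w \<notin> A \<union> B" "\<forall>a\<in>A. (a, w) \<in> E" "\<forall>b\<in>B. (b, w) \<notin> E"
proof -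
  define m where "m = card (A \<union> B)"
  obtain \<beta> where \<beta>: "bij_betw \<beta> {0..<m} (A \<union> B)"
    using ex_bij_betw_nat_finite[of "A \<union> B"] assms m_def by auto
  define W where "W = {0..m}"
  define F where "F = {(i, j). i < m \<and> j < m \<and> (\<beta> i, \<beta> j) \<in> E}
    \<union> {(i, j). i < m \<and> \<beta> i \<in> A \<and> j = m} \<union> {(j, i). i < m \<and> \<beta> i \<in> A \<and> j = m}"
  have "undirected_graph W F"
    using edges by (auto simp: undirected_graph_def W_def F_def sym_def irrefl_def)
  then have "graph_embeds W F V E"
    using random_graph by (auto simp: random_graph_def W_def)
  then obtain X h where X: "X \<subseteq> V" "bij_betw h W X"
    and h: "\<And>x y. x \<in> W \<Longrightarrow> y \<in> W \<Longrightarrow> (x, y) \<in> F \<longleftrightarrow> (h x, h y) \<in> induced E X"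
    by (auto simp: graph_embeds_def graph_iso_def)
  have hX: "h i \<in> X" if "i \<le> m" for i
    using X(2) that by (auto simp: bij_betw_def W_def)
  have hF: "(x, y) \<in> F \<longleftrightarrow> (h x, h y) \<in> E" if "x \<le> m" "y \<le> m" for x y
    using h[of x y] that hX by (auto simp: W_def induced_def)
  \<comment> \<open>the finite partial isomorphism that moves the copy back onto \<open>A \<union> B\<close>\<close>
  define k where "k = \<beta> \<circ> inv_into {0..<m} h"
  have inj: "inj_on h {0..<m}"
    using X(2) by (auto simp: bij_betw_def W_def inj_on_def)
  have k: "k (h i) = \<beta> i" if "i < m" for i
    using inj that by (simp add: k_def)
  have bk: "bij_betw k (h ` {0..<m}) (A \<union> B)"
    unfolding k_def by (rule bij_betw_trans[OF bij_betw_inv_into[OF inj_on_imp_bij_betw[OF inj]] \<beta>])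
  have \<beta>AB: "\<beta> i \<in> A \<union> B" if "i < m" for i
    using \<beta> that by (auto simp: bij_betw_def)
  have "(x, y) \<in> induced E (h ` {0..<m}) \<longleftrightarrow> (k x, k y) \<in> induced E (A \<union> B)"
    if xy: "x \<in> h ` {0..<m}" "y \<in> h ` {0..<m}" for x y
  proof -
    obtain i j where ij: "x = h i" "y = h j" "i < m" "j < m"
      using xy by auto
    then have "(x, y) \<in> E \<longleftrightarrow> (i, j) \<in> F" using hF by simp
    also have "\<dots> \<longleftrightarrow> (\<beta> i, \<beta> j) \<in> E" using ij by (auto simp: F_def)
    finally show ?thesis using ij k \<beta>AB xy by (auto simp: induced_def)
  qed
  then have "graph_iso (h ` {0..<m}) (induced E (h ` {0..<m})) (A \<union> B) (induced E (A \<union> B)) k"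
    using bk by (auto simp: graph_iso_def)
  moreover have "h ` {0..<m} \<subseteq> V" using X hX by auto
  ultimately obtain g where g: "graph_iso V E V E g" "\<forall>x\<in>h ` {0..<m}. g x = k x"
    using random_graph assms unfolding random_graph_def homogeneous_graph_def
    by (metis Un_subset_iff finite_atLeastLessThan finite_imageI)
  have hV: "h i \<in> V" if "i \<le> m" for i using hX X that by auto
  have gh: "g (h i) = \<beta> i" if "i < m" for i using g(2) k that by auto
  have adj: "(\<beta> i, g (h m)) \<in> E \<longleftrightarrow> \<beta> i \<in> A" if "i < m" for i
  proof -
    have "(\<beta> i, g (h m)) \<in> E \<longleftrightarrow> (g (h i), g (h m)) \<in> E" using gh that by simp
    also have "\<dots> \<longleftrightarrow> (h i, h m) \<in> E" using g(1) hV that by (auto simp: graph_iso_def)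
    also have "\<dots> \<longleftrightarrow> (i, m) \<in> F" using hF that by auto
    also have "\<dots> \<longleftrightarrow> \<beta> i \<in> A" using that by (auto simp: F_def)
    finally show ?thesis .
  qed
  have surj: "\<exists>i<m. \<beta> i = x" if "x \<in> A \<union> B" for x
  proof -
    have "x \<in> \<beta> ` {0..<m}" using \<beta> that by (simp add: bij_betw_def)
    then show ?thesis by auto
  qed
  show thesis
  proof
    show "g (h m) \<in> V" using g(1) hV by (auto simp: graph_iso_def bij_betw_def)
    show "g (h m) \<notin> A \<union> B"
    proof
      assume "g (h m) \<in> A \<union> B"
      then obtain i where i: "i < m" "\<beta> i = g (h m)" using surj by blast
      then have "g (h i) = g (h m)" using gh by simp
      then have "h i = h m"
        using g(1) hV i by (auto simp: graph_iso_def bij_betw_def inj_on_def)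
      then have "i = m" using X(2) i by (intro inj_onD[of h W]) (auto simp: bij_betw_def W_def)
      then show False using i by simp
    qed
    show "\<forall>a\<in>A. (a, g (h m)) \<in> E" using surj adj by (metis UnI1)
    show "\<forall>b\<in>B. (b, g (h m)) \<notin> E" using surj adj assms(5) by (metis UnI2 disjoint_iff)
  qed
qed

lemma infinite_vertices: "infinite V"
  using extension_property[of "{}" V] by auto

text \<open>Vertex \<open>i\<close> is placed at stage \<open>i\<close>, nonadjacent to the first \<open>i\<close> vertices of \<open>V\<close> as far as these
  are not images of earlier vertices. So a vertex \<open>v\<^sub>j\<close> outside the image has at most the neighbours
  \<open>e 0, \<dots>, e j\<close> in the image. To extend a homomorphism \<open>h\<close>, run through \<open>V\<close> and map each \<open>v\<^sub>j\<close> outside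
  the image to a common neighbour of \<open>h 0, \<dots>, h j\<close> and of all values chosen so far.\<close>

lemma free_embedding_nat:
  fixes F :: "nat rel"
  assumes "sym F" "irrefl F"
  obtains e where "inj e" "graph_hom UNIV F V E e"
    "\<And>h. graph_hom UNIV F V E h \<Longrightarrow> \<exists>g. graph_hom V E V E g \<and> (\<forall>i. g (e i) = h i)"
proof -
  define v where "v = from_nat_into V"
  have v: "bij_betw v UNIV V"
    unfolding v_def using bij_betw_from_nat_into[OF edges(4) infinite_vertices] .
  have vV: "v i \<in> V" for i using v by (auto simp: bij_betw_def)
  define P where "P f i r \<longleftrightarrow> r \<in> V \<and> (\<forall>j<i. f j \<noteq> r) \<and> (\<forall>j<i. (f j, r) \<in> E \<longleftrightarrow> (j, i) \<in> F) \<and>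
    (\<forall>j<i. v j \<notin> f ` {..<i} \<longrightarrow> (v j, r) \<notin> E)" for f :: "nat \<Rightarrow> 'v" and i r
  have "\<exists>e. \<forall>i. P e i (e i)"
  proof (rule dependent_wellorder_choice)
    fix r and f g :: "nat \<Rightarrow> 'v" and i assume "\<And>j. j < i \<Longrightarrow> f j = g j"
    moreover from this have "f ` {..<i} = g ` {..<i}" by (intro image_cong) auto
    ultimately show "P f i r = P g i r" by (auto simp: P_def)
  next
    fix i f assume IH: "\<And>j. j < i \<Longrightarrow> P f j (f j)"
    define A where "A = f ` {j. j < i \<and> (j, i) \<in> F}"
    define B where "B = f ` {j. j < i \<and> (j, i) \<notin> F} \<union> {x \<in> v ` {..<i}. x \<notin> f ` {..<i}}"
    have fV: "f j \<in> V" if "j < i" for j using IH[OF that] by (simp add: P_def)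
    have inj: "j = k" if "j < i" "k < i" "f j = f k" for j k
      using IH[OF that(1)] IH[OF that(2)] that(3)
      unfolding P_def by (metis linorder_neqE_nat)
    have "A \<inter> B = {}" using inj by (auto simp: A_def B_def)
    moreover have "A \<subseteq> V" "B \<subseteq> V" using fV vV by (auto simp: A_def B_def)
    moreover have "finite A" "finite B" by (auto simp: A_def B_def)
    ultimately obtain w where w: "w \<in> V" "w \<notin> A \<union> B" "\<forall>a\<in>A. (a, w) \<in> E" "\<forall>b\<in>B. (b, w) \<notin> E"
      using extension_property by metis
    have "P f i w"
      unfolding P_def using w by (auto simp: A_def B_def)
    then show "\<exists>r. P f i r" ..
  qed
  then obtain e where e: "\<And>i. P e i (e i)" by blast
  have inj: "inj e"
    by (rule linorder_injI) (use e in \<open>auto simp: P_def\<close>)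
  have eE: "(e i, e j) \<in> E \<longleftrightarrow> (i, j) \<in> F" for i j
  proof (cases i j rule: linorder_cases)
    case less
    then show ?thesis using e[of j] by (auto simp: P_def)
  next
    case equal
    then show ?thesis using assms(2) edges(3) by (auto simp: irrefl_def)
  next
    case greater
    then show ?thesis using e[of i] assms(1) edges(2) unfolding P_def by (metis symE)
  qed
  have eV: "e i \<in> V" for i using e[of i] by (simp add: P_def)
  have few: "m \<le> j" if "v j \<notin> range e" "(v j, e m) \<in> E" for j m
  proof (rule ccontr)
    assume "\<not> m \<le> j"
    moreover have "v j \<notin> e ` {..<m}" using that(1) by blast
    ultimately show False using e[of m] that(2) by (simp add: P_def)
  qed
  have "\<exists>g. graph_hom V E V E g \<and> (\<forall>i. g (e i) = h i)" if h: "graph_hom UNIV F V E h" for h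
  proof -
    define Q where "Q c j r \<longleftrightarrow> r \<in> V \<and> (\<forall>m. v j = e m \<longrightarrow> r = h m) \<and>
      (v j \<notin> range e \<longrightarrow> (\<forall>i<j. (c i, r) \<in> E) \<and> (\<forall>m\<le>j. (h m, r) \<in> E))"
      for c :: "nat \<Rightarrow> 'v" and j r
    have "\<exists>c. \<forall>j. Q c j (c j)"
    proof (rule dependent_wellorder_choice)
      fix r and f g :: "nat \<Rightarrow> 'v" and i assume "\<And>j. j < i \<Longrightarrow> f j = g j"
      then show "Q f i r = Q g i r" by (auto simp: Q_def)
    next
      fix j c assume IH: "\<And>i. i < j \<Longrightarrow> Q c i (c i)"
      show "\<exists>r. Q c j r"
      proof (cases "v j \<in> range e")
        case True
        then obtain m where "v j = e m" by auto
        then have "Q c j (h m)"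
          using inj graph_homD(1)[OF h] by (auto simp: Q_def dest: injD)
        then show ?thesis ..
      next
        case False
        have "c ` {..<j} \<union> h ` {..j} \<subseteq> V"
          using IH graph_homD(1)[OF h] by (auto simp: Q_def)
        then obtain w where "w \<in> V" "\<forall>a\<in>c ` {..<j} \<union> h ` {..j}. (a, w) \<in> E"
          by (rule extension_property[of "c ` {..<j} \<union> h ` {..j}" "{}", rotated 2]) auto
        then have "Q c j w" using False by (auto simp: Q_def)
        then show ?thesis ..
      qed
    qed
    then obtain c where c: "\<And>j. Q c j (c j)" by blast
    have edge: "(c i, c j) \<in> E" if ij: "i < j" "(v i, v j) \<in> E" for i j
    proof (cases "v j \<in> range e")
      case False
      then show ?thesis using c[of j] ij by (auto simp: Q_def)
    next
      case True
      then obtain m where m: "v j = e m" by auto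
      then have cj: "c j = h m" using c[of j] by (auto simp: Q_def)
      show ?thesis
      proof (cases "v i \<in> range e")
        case True
        then obtain l where l: "v i = e l" by auto
        then have "c i = h l" using c[of i] by (auto simp: Q_def)
        moreover have "(l, m) \<in> F" using eE ij l m by auto
        ultimately show ?thesis using cj graph_homD(2)[OF h] by auto
      next
        case False
        then have "m \<le> i" using few ij m by auto
        then have "(h m, c i) \<in> E" using c[of i] False by (auto simp: Q_def)
        then show ?thesis using cj edges(2) by (auto dest: symD)
      qed
    qed
    define g where "g x = c (inv v x)" for x
    have gv: "g (v i) = c i" for i using v by (simp add: g_def bij_betw_def)
    have "(g x, g y) \<in> E" if xy: "(x, y) \<in> E" for x y
    proof -
      have "x \<in> range v" "y \<in> range v" using xy edges(1) v by (auto simp: bij_betw_def)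
      then obtain i j where ij: "x = v i" "y = v j" by auto
      have "i \<noteq> j" using xy ij edges(3) by (auto simp: irrefl_def)
      then show ?thesis
        using edge[of i j] edge[of j i] xy ij gv edges(2) by (metis linorder_neqE_nat symE)
    qed
    moreover have "g x \<in> V" for x using c by (simp add: Q_def g_def)
    moreover have "g (e m) = h m" for m
    proof -
      have "e m \<in> range v" using eV v by (auto simp: bij_betw_def)
      then obtain j where "e m = v j" by auto
      then show ?thesis using c[of j] gv by (auto simp: Q_def)
    qed
    ultimately show ?thesis by (intro exI[of _ g]) (auto simp: graph_hom_def)
  qed
  moreover have "graph_hom UNIV F V E e" using eE eV by (auto simp: graph_hom_def)
  ultimately show thesis using that inj by blast
qed

text \<open>A countable graph becomes a graph on all natural numbers by numbering its vertices; numbers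
  that are not used are isolated vertices, which constrain no homomorphism.\<close>

lemma free_embedding:
  assumes "countable W" "undirected_graph W F"
  obtains e where "inj_on e W" "graph_hom W F V E e"
    "\<And>h. graph_hom W F V E h \<Longrightarrow> \<exists>g. graph_hom V E V E g \<and> (\<forall>x\<in>W. g (e x) = h x)"
proof -
  define n where "n = to_nat_on W"
  have n: "inj_on n W" unfolding n_def by (rule inj_on_to_nat_on[OF assms(1)])
  have F: "F \<subseteq> W \<times> W" "sym F" "irrefl F" using assms(2) by (auto simp: undirected_graph_def)
  define G where "G = {(n x, n y) | x y. (x, y) \<in> F}"
  have "sym G" using F(2) by (fastforce simp: G_def dest: symD intro: symI)
  moreover have "irrefl G"
    using F n by (fastforce simp: G_def irrefl_def inj_on_def)
  ultimately obtain e where e: "inj e" "graph_hom UNIV G V E e"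
    "\<And>h. graph_hom UNIV G V E h \<Longrightarrow> \<exists>g. graph_hom V E V E g \<and> (\<forall>i. g (e i) = h i)"
    by (rule free_embedding_nat) blast
  have "inj_on (e \<circ> n) W" using e(1) n by (simp add: comp_inj_on inj_on_subset)
  moreover have "graph_hom W F V E (e \<circ> n)"
    using e(2) by (fastforce simp: graph_hom_def G_def)
  moreover have "\<exists>g. graph_hom V E V E g \<and> (\<forall>x\<in>W. g ((e \<circ> n) x) = h x)"
    if h: "graph_hom W F V E h" for h
  proof -
    define k where "k i = (if i \<in> n ` W then h (inv_into W n i) else e 0)" for i
    have k: "k (n x) = h x" if "x \<in> W" for x using n that by (simp add: k_def)
    have "graph_hom UNIV G V E k"
      unfolding graph_hom_def
    proof (intro conjI)
      show "range k \<subseteq> V"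
        using graph_homD(1)[OF h] graph_homD(1)[OF e(2)] by (auto simp: k_def inv_into_into)
      show "\<forall>(x, y)\<in>G. (k x, k y) \<in> E"
        using graph_homD(2)[OF h] F(1) by (auto simp: G_def) (metis SigmaE2 k subsetD)
    qed
    then show ?thesis using e(3) k by fastforce
  qed
  ultimately show thesis by (rule that)
qed

text \<open>The blow-up of \<open>P\<close> replaces a vertex \<open>p\<close> with number \<open>i\<close> by one copy for every subset \<open>A\<close> of
  \<open>{..<i}\<close>, that is, for every node of level \<open>i\<close> of the binary tree. Adjacency requires the two
  nodes to lie on a common branch. A set \<open>X\<close> of natural numbers is an infinite branch and yields a
  copy of \<open>P\<close> in the blow-up, whose free embedding in \<open>V\<close> is \<open>a X\<close>. If the branches \<open>X\<close> and \<open>Y\<close>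
  disagree about \<open>n\<close>, then mapping the copies by \<open>t\<close> or \<open>s\<close> according to their opinion about \<open>n\<close> is
  a homomorphism as soon as \<open>s\<close> and \<open>t\<close> agree on the vertices too low in the tree to have an
  opinion, and there are only finitely many of these.\<close>

lemma cantor_family:
  fixes P :: "'p set"
  assumes "countable P" "undirected_graph P R"
  obtains a :: "nat set \<Rightarrow> 'p \<Rightarrow> 'v" where "\<And>X. graph_hom P R V E (a X)"
    "\<And>X Y. X \<noteq> Y \<Longrightarrow> \<exists>F. finite F \<and> F \<subseteq> P \<and>
      (\<forall>s t. graph_hom P R V E s \<longrightarrow> graph_hom P R V E t \<longrightarrow> (\<forall>p\<in>F. s p = t p) \<longrightarrow>
        (\<exists>h. graph_hom V E V E h \<and> (\<forall>p\<in>P. h (a X p) = s p \<and> h (a Y p) = t p)))"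
proof -
  define idx where "idx = to_nat_on P"
  have idx: "inj_on idx P" unfolding idx_def by (rule inj_on_to_nat_on[OF assms(1)])
  have R: "R \<subseteq> P \<times> P" "sym R" "irrefl R" using assms(2) by (auto simp: undirected_graph_def)
  define W where "W = (SIGMA p:P. Pow {..<idx p})"
  define S where "S = {((p, A), (q, B)) | p A q B. (p, q) \<in> R \<and> (p, A) \<in> W \<and> (q, B) \<in> W \<and>
    A \<inter> {..<idx q} = B \<inter> {..<idx p}}"
  have "countable W" unfolding W_def
    by (rule countable_SIGMA[OF assms(1)]) (simp add: countable_finite)
  moreover have "undirected_graph W S"
    using R by (auto simp: undirected_graph_def S_def sym_def irrefl_def)
  ultimately obtain e where e: "inj_on e W" "graph_hom W S V E e"
    "\<And>h. graph_hom W S V E h \<Longrightarrow> \<exists>g. graph_hom V E V E g \<and> (\<forall>x\<in>W. g (e x) = h x)"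
    by (rule free_embedding) blast
  define b where "b X p = (p, X \<inter> {..<idx p})" for X p
  have bW: "b X p \<in> W" if "p \<in> P" for X p using that by (auto simp: b_def W_def)
  have "graph_hom P R W S (b X)" for X
    using bW R(1) by (auto simp: graph_hom_def S_def b_def)
  then have hom: "graph_hom P R V E (\<lambda>p. e (b X p))" for X
    by (rule graph_hom_comp[OF _ e(2)])
  have split: "\<exists>h. graph_hom V E V E h \<and> (\<forall>p\<in>P. h (e (b X p)) = s p \<and> h (e (b Y p)) = t p)"
    if n: "n \<in> Y" "n \<notin> X" and s: "graph_hom P R V E s" and t: "graph_hom P R V E t"
      and st: "\<forall>p\<in>{p \<in> P. idx p \<le> n}. s p = t p" for X Y n s t
  proof -
    define k where "k = (\<lambda>(p, A). if n \<in> A then t p else s p)"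
    have "(k (p, A), k (q, B)) \<in> E" if "((p, A), (q, B)) \<in> S" for p A q B
    proof -
      have pq: "(p, q) \<in> R" "A \<subseteq> {..<idx p}" "B \<subseteq> {..<idx q}"
        "A \<inter> {..<idx q} = B \<inter> {..<idx p}" "p \<in> P" "q \<in> P"
        using that by (auto simp: S_def W_def)
      have "n \<in> A \<longleftrightarrow> n \<in> B" if "n < idx p" "n < idx q" using pq(4) that by blast
      moreover have "s p = t p" if "idx p \<le> n" using st that pq by auto
      moreover have "s q = t q" if "idx q \<le> n" using st that pq by auto
      moreover have "n \<in> A \<Longrightarrow> n < idx p" "n \<in> B \<Longrightarrow> n < idx q" using pq by auto
      ultimately show ?thesis
        using graph_homD(2)[OF s pq(1)] graph_homD(2)[OF t pq(1)]
        by (auto simp: k_def) (metis not_le)+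
    qed
    then have "graph_hom W S V E k"
      using graph_homD(1)[OF s] graph_homD(1)[OF t]
      by (auto simp: graph_hom_def W_def k_def)
    then obtain g where g: "graph_hom V E V E g" "\<forall>x\<in>W. g (e x) = k x"
      using e(3) by blast
    have "k (b X p) = s p" "k (b Y p) = t p" if "p \<in> P" for p
      using n st that by (auto simp: k_def b_def)
    then show ?thesis using g bW by auto
  qed
  show thesis
  proof (rule that[of "\<lambda>X p. e (b X p)"])
    fix X Y :: "nat set" assume "X \<noteq> Y"
    then obtain n where n: "n \<in> Y \<and> n \<notin> X \<or> n \<in> X \<and> n \<notin> Y" by blast
    have "finite {p \<in> P. idx p \<le> n}"
      by (rule finite_imageD[of idx]) (auto intro: finite_subset[of _ "{..n}"] inj_on_subset[OF idx])
    moreover have "\<exists>h. graph_hom V E V E h \<and> (\<forall>p\<in>P. h (e (b X p)) = s p \<and> h (e (b Y p)) = t p)"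
      if "graph_hom P R V E s" "graph_hom P R V E t" "\<forall>p\<in>{p \<in> P. idx p \<le> n}. s p = t p" for s t
    proof (cases "n \<in> Y")
      case True
      then show ?thesis using n split[of n Y X s t] that by blast
    next
      case False
      then have "\<exists>h. graph_hom V E V E h \<and> (\<forall>p\<in>P. h (e (b Y p)) = t p \<and> h (e (b X p)) = s p)"
        using n that by (intro split[of n]) auto
      then show ?thesis by blast
    qed
    ultimately show "\<exists>F. finite F \<and> F \<subseteq> P \<and>
      (\<forall>s t. graph_hom P R V E s \<longrightarrow> graph_hom P R V E t \<longrightarrow> (\<forall>p\<in>F. s p = t p) \<longrightarrow>
        (\<exists>h. graph_hom V E V E h \<and> (\<forall>p\<in>P. h (e (b X p)) = s p \<and> h (e (b Y p)) = t p)))"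
      by (intro exI[of _ "{p \<in> P. idx p \<le> n}"]) auto
  qed (rule hom)
qed

text \<open>Freely embed \<open>P\<close> with a twin of the vertex \<open>p\<close> added (\<open>None\<close> below); then use \<open>p\<close> once as it is and
  once replaced by its twin.\<close>

lemma homs_differing_at_one_vertex:
  assumes "countable P" "undirected_graph P R" "p \<in> P"
  obtains u v where "graph_hom P R V E u" "graph_hom P R V E v"
    "\<And>q. q \<in> P \<Longrightarrow> u q = v q \<longleftrightarrow> q \<noteq> p"
proof -
  define \<pi> where "\<pi> = case_option p (\<lambda>q. q)"
  define W where "W = insert None (Some ` P)"
  define S where "S = {(x, y). x \<in> W \<and> y \<in> W \<and> (\<pi> x, \<pi> y) \<in> R}"
  have R: "R \<subseteq> P \<times> P" "sym R" "irrefl R" using assms(2) by (auto simp: undirected_graph_def)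
  have "countable W" using assms(1) by (simp add: W_def)
  moreover have "undirected_graph W S"
    using R by (auto simp: undirected_graph_def S_def sym_def irrefl_def)
  ultimately obtain e where e: "inj_on e W" "graph_hom W S V E e"
    by (rule free_embedding) blast
  define b where "b q = (if q = p then None else Some q)" for q
  have "graph_hom P R W S Some" "graph_hom P R W S b"
    using R(1) assms(3) by (auto simp: graph_hom_def W_def S_def \<pi>_def b_def)
  then have "graph_hom P R V E (\<lambda>q. e (Some q))" "graph_hom P R V E (\<lambda>q. e (b q))"
    by (auto intro: graph_hom_comp[OF _ e(2)])
  moreover have "e (Some q) = e (b q) \<longleftrightarrow> q \<noteq> p" if "q \<in> P" for q
    using e(1) that by (auto simp: b_def W_def inj_on_def)
  ultimately show thesis by (rule that)
qed

section \<open>The polymorphism clone\<close>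

definition tuple_edges :: "nat \<Rightarrow> 'v list rel" where
  "tuple_edges n =
     {(us, vs). us \<in> tuples V n \<and> vs \<in> tuples V n \<and> list_all2 (\<lambda>u v. (u, v) \<in> E) us vs}"

lemma countable_tuples: "countable (tuples V n)"
proof -
  have "tuples V n \<subseteq> lists V" by (auto simp: tuples_def)
  then show ?thesis using countable_lists[OF edges(4)] countable_subset by blast
qed

text \<open>The arity must be positive: the single empty tuple would be adjacent to itself.\<close>

lemma undirected_tuple_graph:
  assumes "n \<ge> 1" shows "undirected_graph (tuples V n) (tuple_edges n)"
proof -
  have "sym (tuple_edges n)"
    using edges(2) by (auto simp: sym_def tuple_edges_def list_all2_conv_all_nth)
  moreover have "irrefl (tuple_edges n)"
  proof (rule irreflI)
    fix us show "(us, us) \<notin> tuple_edges n"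
    proof
      assume "(us, us) \<in> tuple_edges n"
      then have "(us ! 0, us ! 0) \<in> E"
        using assms by (simp add: tuple_edges_def tuples_def list_all2_conv_all_nth)
      then show False using edges(3) by (simp add: irrefl_def)
    qed
  qed
  ultimately show ?thesis by (auto simp: undirected_graph_def tuple_edges_def)
qed

lemma Pol_iff:
  "(n, f) \<in> Pol V E \<longleftrightarrow>
    n \<ge> 1 \<and> f \<in> extensional (tuples V n) \<and> graph_hom (tuples V n) (tuple_edges n) V E f"
  by (auto simp: Pol_def all_ops_def graph_hom_def tuple_edges_def PiE_iff)

lemma Pol_restrict:
  assumes "n \<ge> 1" "graph_hom (tuples V n) (tuple_edges n) V E f"
  shows "(n, restrict f (tuples V n)) \<in> Pol V E"
proof -
  have "graph_hom (tuples V n) (tuple_edges n) V E (restrict f (tuples V n))"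
    using assms(2) by (subst graph_hom_cong[where g = f]) (auto simp: tuple_edges_def)
  then show ?thesis using assms(1) by (simp add: Pol_iff)
qed

lemma Pol_subset_all_ops: "Pol V E \<subseteq> all_ops V"
  by (auto simp: Pol_def)

lemma Pol_hom:
  assumes "f \<in> Pol V E"
  shows "graph_hom (tuples V (fst f)) (tuple_edges (fst f)) V E (snd f)" "fst f \<ge> 1"
    "snd f \<in> extensional (tuples V (fst f))"
  using assms Pol_iff[of "fst f" "snd f"] by auto

lemma function_clone_Pol: "function_clone V (Pol V E)"
  unfolding function_clone_def
proof (intro conjI allI impI)
  show "Pol V E \<subseteq> all_ops V" by (rule Pol_subset_all_ops)
  fix n k :: nat assume "1 \<le> n" "k < n"
  moreover from this have "graph_hom (tuples V n) (tuple_edges n) V E (\<lambda>xs. xs ! k)"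
    by (auto simp: graph_hom_def tuple_edges_def tuples_def list_all2_conv_all_nth)
  ultimately show "proj_op V n k \<in> Pol V E"
    unfolding proj_op_def by (intro Pol_restrict)
next
  fix m f gs assume c: "composable (Pol V E) m f gs"
  have f: "f \<in> Pol V E" and g: "\<And>g. g \<in> set gs \<Longrightarrow> g \<in> Pol V E \<and> fst g = m"
    and l: "length gs = fst f"
    using c by (auto simp: composable_def)
  have "gs \<noteq> []" using Pol_hom(2)[OF f] l by auto
  then have "m \<ge> 1" using g[of "hd gs"] Pol_hom(2)[of "hd gs"] by auto
  moreover have gh: "graph_hom (tuples V m) (tuple_edges m) V E (snd g)" if "g \<in> set gs" for g
    using g[OF that] Pol_hom(1)[of g] by auto
  have "map (\<lambda>g. snd g xs) gs \<in> tuples V (fst f)" if "xs \<in> tuples V m" for xs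
    using graph_homD(1)[OF gh] that l by (auto simp: tuples_def)
  moreover have "list_all2 (\<lambda>u v. (u, v) \<in> E) (map (\<lambda>g. snd g xs) gs) (map (\<lambda>g. snd g ys) gs)"
    if "(xs, ys) \<in> tuple_edges m" for xs ys
    using graph_homD(2)[OF gh] that by (auto simp: list_all2_conv_all_nth)
  ultimately have "graph_hom (tuples V m) (tuple_edges m)
      (tuples V (fst f)) (tuple_edges (fst f)) (\<lambda>xs. map (\<lambda>g. snd g xs) gs)"
    by (auto simp: graph_hom_def) (auto simp: tuple_edges_def)
  then have "graph_hom (tuples V m) (tuple_edges m) V E (\<lambda>xs. snd f (map (\<lambda>g. snd g xs) gs))"
    by (rule graph_hom_comp[OF _ Pol_hom(1)[OF f]])
  then show "comp_op V m f gs \<in> Pol V E"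
    unfolding comp_op_def using \<open>m \<ge> 1\<close> by (intro Pol_restrict)
qed

text \<open>That an operation fails to be a polymorphism is witnessed by its values at two tuples.\<close>

lemma closedin_Pol: "closedin (op_topology V) (Pol V E)"
proof -
  have "openin (subtopology (op_topology V) (all_ops V)) (all_ops V - Pol V E)"
  proof (subst openin_clone_iff, simp, intro conjI ballI)
    fix f assume f: "f \<in> all_ops V - Pol V E"
    obtain n f' where nf: "f = (n, f')" by force
    then obtain us vs where uv: "us \<in> tuples V n" "vs \<in> tuples V n"
      "list_all2 (\<lambda>u v. (u, v) \<in> E) us vs" "(f' us, f' vs) \<notin> E"
      using f by (auto simp: Pol_def)
    show "\<exists>F. finite F \<and> F \<subseteq> tuples V (fst f) \<and> (\<forall>g\<in>all_ops V. fst g = fst f \<longrightarrow>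
        (\<forall>x\<in>F. snd g x = snd f x) \<longrightarrow> g \<in> all_ops V - Pol V E)"
      using uv nf by (intro exI[of _ "{us, vs}"]) (fastforce simp: Pol_def)
  qed auto
  then show ?thesis
    using Pol_subset_all_ops
    by (metis closedin_def subtopology_topspace topspace_op_topology)
qed

lemma closed_subclone_Pol: "closed_subclone V (Pol V E)"
  using edges(4) infinite_vertices function_clone_Pol closedin_Pol
  by (simp add: closed_subclone_def)

section \<open>Clone isomorphisms\<close>

text \<open>The countable set \<open>D'\<close> cannot separate the uncountably many members of \<open>cantor_family\<close>. A
  coincidence \<open>\<phi>(a\<^sub>X)(d) = \<phi>(a\<^sub>Y)(d)\<close> is inherited by every pair \<open>h a\<^sub>X\<close>, \<open>h a\<^sub>Y\<close>, and
  such pairs include all pairs of polymorphisms that agree on a certain finite set. The set does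
  not depend on \<open>f\<close>, so evaluation at \<open>d\<close> is even uniformly continuous.\<close>

lemma locally_constant_evaluation:
  assumes D': "countable D'" and C': "C' \<subseteq> all_ops D'" and \<phi>: "clone_iso V (Pol V E) D' C' \<phi>"
    and n: "n \<ge> 1" and d: "d \<in> tuples D' n"
  shows "\<exists>F. finite F \<and> F \<subseteq> tuples V n \<and> (\<forall>f\<in>Pol V E. \<forall>g\<in>Pol V E.
    fst f = n \<longrightarrow> fst g = n \<longrightarrow> (\<forall>x\<in>F. snd g x = snd f x) \<longrightarrow> snd (\<phi> g) d = snd (\<phi> f) d)"
proof -
  let ?P = "tuples V n" and ?R = "tuple_edges n"
  obtain a :: "nat set \<Rightarrow> 'v list \<Rightarrow> 'v" where a: "\<And>X. graph_hom ?P ?R V E (a X)"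
    and a_split: "\<And>X Y. X \<noteq> Y \<Longrightarrow> \<exists>F. finite F \<and> F \<subseteq> ?P \<and>
      (\<forall>s t. graph_hom ?P ?R V E s \<longrightarrow> graph_hom ?P ?R V E t \<longrightarrow> (\<forall>p\<in>F. s p = t p) \<longrightarrow>
        (\<exists>h. graph_hom V E V E h \<and> (\<forall>p\<in>?P. h (a X p) = s p \<and> h (a Y p) = t p)))"
    by (rule cantor_family[OF countable_tuples undirected_tuple_graph[OF n]]) blast
  define \<alpha> where "\<alpha> X = (n, restrict (a X) ?P)" for X
  have \<alpha>: "\<alpha> X \<in> Pol V E" for X unfolding \<alpha>_def by (rule Pol_restrict[OF n a])
  have \<phi>D: "\<phi> f \<in> C'" "fst (\<phi> f) = fst f" if "f \<in> Pol V E" for f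
    using \<phi> that by (auto simp: clone_iso_def bij_betw_def)
  have "snd (\<phi> (\<alpha> X)) d \<in> D'" for X
  proof -
    have "snd (\<phi> (\<alpha> X)) \<in> tuples D' n \<rightarrow>\<^sub>E D'"
      using all_opsD(2)[OF C' \<phi>D(1)[OF \<alpha>[of X]]] \<phi>D(2)[OF \<alpha>[of X]] by (simp add: \<alpha>_def)
    then show ?thesis using d by (rule PiE_mem)
  qed
  then have "range (\<lambda>X. snd (\<phi> (\<alpha> X)) d) \<subseteq> D'" by auto
  moreover have "uncountable (UNIV :: nat set set)"
  proof
    assume "countable (UNIV :: nat set set)"
    then have "range (from_nat_into (UNIV :: nat set set)) = Pow UNIV"
      using range_from_nat_into[of "UNIV :: nat set set"] by simp
    then show False using Cantors_theorem[of "UNIV :: nat set"] by blast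
  qed
  ultimately have "\<not> inj (\<lambda>X. snd (\<phi> (\<alpha> X)) d)"
    using D' by (metis countable_image_inj_on countable_subset)
  then obtain X Y where XY: "X \<noteq> Y" "snd (\<phi> (\<alpha> X)) d = snd (\<phi> (\<alpha> Y)) d"
    by (auto simp: inj_def)
  obtain F where F: "finite F" "F \<subseteq> ?P"
    "\<And>s t. graph_hom ?P ?R V E s \<Longrightarrow> graph_hom ?P ?R V E t \<Longrightarrow> \<forall>p\<in>F. s p = t p \<Longrightarrow>
        \<exists>h. graph_hom V E V E h \<and> (\<forall>p\<in>?P. h (a X p) = s p \<and> h (a Y p) = t p)"
    using a_split[OF XY(1)] by metis
  have "snd (\<phi> g) d = snd (\<phi> f) d"
    if fg: "f \<in> Pol V E" "g \<in> Pol V E" "fst f = n" "fst g = n" "\<forall>x\<in>F. snd g x = snd f x" for f g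
  proof -
    obtain h where h: "graph_hom V E V E h"
      "\<forall>p\<in>?P. h (a X p) = snd g p \<and> h (a Y p) = snd f p"
      using F(3)[of "snd g" "snd f"] Pol_hom(1)[OF fg(1)] Pol_hom(1)[OF fg(2)] fg by auto
    \<comment> \<open>\<open>h\<close> as a unary operation\<close>
    define \<eta> where "\<eta> = (1 :: nat, \<lambda>xs\<in>tuples V 1. h (xs ! 0))"
    have "graph_hom (tuples V 1) (tuple_edges 1) V E (\<lambda>xs. h (xs ! 0))"
      using graph_homD[OF h(1)]
      by (auto simp: graph_hom_def tuples_def tuple_edges_def list_all2_conv_all_nth subset_iff)
    then have \<eta>: "\<eta> \<in> Pol V E" unfolding \<eta>_def by (intro Pol_restrict) auto
    have val: "snd (\<phi> k) d = snd (\<phi> \<eta>) [snd (\<phi> (\<alpha> Z)) d]"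
      if k: "k \<in> Pol V E" "fst k = n" "\<forall>p\<in>?P. h (a Z p) = snd k p" for k Z
    proof -
      have "snd k = (\<lambda>xs\<in>?P. snd \<eta> [snd (\<alpha> Z) xs])"
      proof (rule extensionalityI[of _ ?P])
        show "snd k \<in> extensional ?P" using Pol_hom(3)[OF k(1)] k(2) by simp
        fix x assume x: "x \<in> ?P"
        then have "[a Z x] \<in> tuples V 1" using graph_homD(1)[OF a x] by (auto simp: tuples_def)
        then show "snd k x = (\<lambda>xs\<in>?P. snd \<eta> [snd (\<alpha> Z) xs]) x"
          using x k(3) by (simp add: \<eta>_def \<alpha>_def)
      qed simp
      then have "k = comp_op V n \<eta> [\<alpha> Z]"
        using k(2) by (simp add: comp_op_def prod_eq_iff)
      moreover have "composable (Pol V E) n \<eta> [\<alpha> Z]"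
        using \<eta> \<alpha> by (simp add: composable_def \<eta>_def \<alpha>_def)
      ultimately have "\<phi> k = comp_op D' n (\<phi> \<eta>) [\<phi> (\<alpha> Z)]"
        using clone_iso_comp[OF \<phi>, of n \<eta> "[\<alpha> Z]"] by simp
      then show ?thesis using d by (simp add: comp_op_def)
    qed
    show ?thesis using val[of g X] val[of f Y] h(2) fg XY(2) by simp
  qed
  then show ?thesis using F(1,2) by (intro exI[of _ F] conjI ballI impI)
qed

text \<open>With \<open>u\<close>, \<open>v\<close> differing only at \<open>(f(a), a)\<close>, the condition \<open>g(a) = f(a)\<close> is the failure of
  the equation \<open>u(g, \<pi>\<^sub>1, \<dots>, \<pi>\<^sub>n) = v(g, \<pi>\<^sub>1, \<dots>, \<pi>\<^sub>n)\<close> in the language of clones. The projections supply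
  the arguments to \<open>u\<close> and \<open>v\<close>, so that the equation can single out the tuple \<open>a\<close>. The tuple \<open>d\<close>
  is one at which the image of the equation fails for \<open>f\<close>.\<close>

lemma value_detected_at_one_tuple:
  assumes C': "C' \<subseteq> all_ops D'" and \<phi>: "clone_iso V (Pol V E) D' C' \<phi>"
    and f: "f \<in> Pol V E" and a: "a \<in> tuples V (fst f)"
  shows "\<exists>d\<in>tuples D' (fst f). \<forall>g\<in>Pol V E. fst g = fst f \<longrightarrow>
    snd (\<phi> g) d = snd (\<phi> f) d \<longrightarrow> snd g a = snd f a"
proof -
  define n where "n = fst f"
  have n: "n \<ge> 1" using Pol_hom(2)[OF f] by (simp add: n_def)
  have a': "a \<in> tuples V n" using a by (simp add: n_def)
  define b where "b = snd f a"
  have "b \<in> V" using graph_homD(1)[OF Pol_hom(1)[OF f] a] by (simp add: b_def)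
  then have "b # a \<in> tuples V (Suc n)" using a' by (auto simp: tuples_def)
  from homs_differing_at_one_vertex[OF countable_tuples undirected_tuple_graph this]
  obtain u v where uv: "graph_hom (tuples V (Suc n)) (tuple_edges (Suc n)) V E u"
    "graph_hom (tuples V (Suc n)) (tuple_edges (Suc n)) V E v"
    "\<And>q. q \<in> tuples V (Suc n) \<Longrightarrow> u q = v q \<longleftrightarrow> q \<noteq> b # a"
    by (metis One_nat_def Suc_le_mono le0)
  define \<mu> where "\<mu> = (Suc n, restrict u (tuples V (Suc n)))"
  define \<nu> where "\<nu> = (Suc n, restrict v (tuples V (Suc n)))"
  have \<mu>: "\<mu> \<in> Pol V E" and \<nu>: "\<nu> \<in> Pol V E"
    unfolding \<mu>_def \<nu>_def using uv by (auto intro: Pol_restrict)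
  define with_projs where "with_projs g = g # map (proj_op V n) [0..<n]" for g :: "'v operation"
  have projs: "map (\<lambda>k. xs ! k) [0..<n] = xs" if "xs \<in> tuples D n" for D :: "'z set" and xs
    using that by (auto simp: tuples_def intro: map_nth)
  have composable: "composable (Pol V E) n \<kappa> (with_projs g)"
    if "g \<in> Pol V E" "fst g = n" "\<kappa> \<in> {\<mu>, \<nu>}" for g \<kappa>
    using that \<mu> \<nu> function_clone_Pol n
    by (auto simp: composable_def with_projs_def \<mu>_def \<nu>_def proj_op_def function_clone_def)
  have lhs: "snd (comp_op V n \<kappa> (with_projs g)) xs = snd \<kappa> (snd g xs # xs)"
    if "xs \<in> tuples V n" for xs g \<kappa>
  proof -
    have "map (\<lambda>k. snd (proj_op V n k) xs) [0..<n] = map (\<lambda>k. xs ! k) [0..<n]"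
      using that by (simp add: proj_op_def)
    then show ?thesis using that projs[OF that] by (simp add: comp_op_def with_projs_def o_def)
  qed
  have rhs: "snd (\<phi> (comp_op V n \<kappa> (with_projs g))) d = snd (\<phi> \<kappa>) (snd (\<phi> g) d # d)"
    if "g \<in> Pol V E" "fst g = n" "\<kappa> \<in> {\<mu>, \<nu>}" "d \<in> tuples D' n" for g \<kappa> d
  proof -
    have "\<phi> (comp_op V n \<kappa> (with_projs g)) = comp_op D' n (\<phi> \<kappa>) (map \<phi> (with_projs g))"
      by (rule clone_iso_comp[OF \<phi> composable[OF that(1-3)]])
    moreover have "map \<phi> (with_projs g) = \<phi> g # map (proj_op D' n) [0..<n]"
      using \<phi> n by (simp add: with_projs_def clone_iso_def)
    moreover have "map (\<lambda>k. snd (proj_op D' n k) d) [0..<n] = map (\<lambda>k. d ! k) [0..<n]"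
      using that by (simp add: proj_op_def)
    ultimately show ?thesis
      using that projs[OF that(4)] by (simp add: comp_op_def o_def)
  qed
  define U where "U g = comp_op V n \<mu> (with_projs g)" for g
  define W where "W g = comp_op V n \<nu> (with_projs g)" for g
  have UW: "U g \<in> Pol V E" "W g \<in> Pol V E" "fst (U g) = n" "fst (W g) = n"
    if "g \<in> Pol V E" "fst g = n" for g
  proof -
    have "comp_op V n \<kappa> (with_projs g) \<in> Pol V E" if "\<kappa> \<in> {\<mu>, \<nu>}" for \<kappa>
      using composable[OF \<open>g \<in> Pol V E\<close> \<open>fst g = n\<close> that] function_clone_Pol
      unfolding function_clone_def by blast
    then show "U g \<in> Pol V E" "W g \<in> Pol V E" by (auto simp: U_def W_def)
    show "fst (U g) = n" "fst (W g) = n" by (simp_all add: U_def W_def comp_op_def)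
  qed
  have eq_iff: "U g = W g \<longleftrightarrow> snd g a \<noteq> b" if g: "g \<in> Pol V E" "fst g = n" for g
  proof -
    have "snd (U g) xs = snd (W g) xs \<longleftrightarrow> snd g xs # xs \<noteq> b # a" if xs: "xs \<in> tuples V n" for xs
    proof -
      have "snd g xs # xs \<in> tuples V (Suc n)"
        using graph_homD(1)[OF Pol_hom(1)[OF g(1)], of xs] xs g(2) by (auto simp: tuples_def)
      then show ?thesis using uv(3) xs by (simp add: U_def W_def lhs \<mu>_def \<nu>_def)
    qed
    moreover have "U g = W g \<longleftrightarrow> (\<forall>xs\<in>tuples V n. snd (U g) xs = snd (W g) xs)"
      using extensionalityI[of "snd (U g)" "tuples V n" "snd (W g)"]
        Pol_hom(3)[OF UW(1)[OF g]] Pol_hom(3)[OF UW(2)[OF g]] UW(3,4)[OF g]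
      by (auto simp: prod_eq_iff)
    ultimately show ?thesis using a' by auto
  qed
  have fn: "f \<in> Pol V E" "fst f = n" using f by (auto simp: n_def)
  have "U f \<noteq> W f" using eq_iff[OF fn] by (simp add: b_def)
  then have "\<phi> (U f) \<noteq> \<phi> (W f)"
    using \<phi> UW[OF fn] by (auto simp: clone_iso_def bij_betw_def inj_on_def)
  moreover have "\<phi> (U f) \<in> C'" "\<phi> (W f) \<in> C'" "fst (\<phi> (U f)) = n" "fst (\<phi> (W f)) = n"
    using \<phi> UW[OF fn] by (auto simp: clone_iso_def bij_betw_def)
  moreover from this have "snd (\<phi> (U f)) \<in> tuples D' n \<rightarrow>\<^sub>E D'"
    "snd (\<phi> (W f)) \<in> tuples D' n \<rightarrow>\<^sub>E D'"
    using all_opsD(2)[OF C'] by metis+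
  ultimately obtain d where d: "d \<in> tuples D' n" "snd (\<phi> (U f)) d \<noteq> snd (\<phi> (W f)) d"
    using PiE_ext by (metis prod_eq_iff)
  have "snd g a = b" if g: "g \<in> Pol V E" "fst g = n" "snd (\<phi> g) d = snd (\<phi> f) d" for g
  proof -
    have "snd (\<phi> (U g)) d \<noteq> snd (\<phi> (W g)) d"
      using d(2) g(3) rhs[OF g(1,2) _ d(1)] rhs[OF fn _ d(1)] by (simp add: U_def W_def)
    then have "U g \<noteq> W g" by auto
    then show ?thesis using eq_iff[OF g(1,2)] by simp
  qed
  then show ?thesis using d(1) unfolding n_def b_def by blast
qed

lemma automatic_homeomorphicity_Pol: "automatic_homeomorphicity TYPE('b) V (Pol V E)"
  unfolding automatic_homeomorphicity_def
proof (intro conjI allI impI closed_subclone_Pol)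
  fix D' :: "'b set" and C' \<phi>
  assume cl: "closed_subclone D' C'" and iso: "clone_iso V (Pol V E) D' C' \<phi>"
  have C': "C' \<subseteq> all_ops D'" and D': "countable D'"
    using cl by (auto simp: closed_subclone_def function_clone_def)
  have bij: "bij_betw \<phi> (Pol V E) C'" and ar: "\<And>f. f \<in> Pol V E \<Longrightarrow> fst (\<phi> f) = fst f"
    using iso by (auto simp: clone_iso_def)
  define \<psi> where "\<psi> = inv_into (Pol V E) \<phi>"
  have \<psi>: "\<psi> f \<in> Pol V E" "\<phi> (\<psi> f) = f" "fst (\<psi> f) = fst f" if "f \<in> C'" for f
    using bij that ar[of "\<psi> f"] by (auto simp: \<psi>_def bij_betw_def inv_into_into f_inv_into_f)
  have \<psi>\<phi>: "\<psi> (\<phi> f) = f" if "f \<in> Pol V E" for f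
    using bij that by (simp add: \<psi>_def bij_betw_def)
  have "continuous_map (subtopology (op_topology V) (Pol V E)) (subtopology (op_topology D') C') \<phi>"
  proof (rule continuous_map_clone[OF Pol_subset_all_ops C' _ ar])
    show "\<phi> ` Pol V E \<subseteq> C'" using bij by (simp add: bij_betw_def)
    fix f d assume "f \<in> Pol V E" "d \<in> tuples D' (fst f)"
    then show "\<exists>F. finite F \<and> F \<subseteq> tuples V (fst f) \<and> (\<forall>g\<in>Pol V E. fst g = fst f \<longrightarrow>
        (\<forall>x\<in>F. snd g x = snd f x) \<longrightarrow> snd (\<phi> g) d = snd (\<phi> f) d)"
      using locally_constant_evaluation[OF D' C' iso Pol_hom(2)] by metis
  qed
  moreover have
    "continuous_map (subtopology (op_topology D') C') (subtopology (op_topology V) (Pol V E)) \<psi>"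
  proof (rule continuous_map_clone[OF C' Pol_subset_all_ops _ \<psi>(3)])
    show "\<psi> ` C' \<subseteq> Pol V E" using \<psi>(1) by auto
    fix f a assume f: "f \<in> C'" "a \<in> tuples V (fst f)"
    then obtain d where d: "d \<in> tuples D' (fst f)" "\<forall>g\<in>Pol V E. fst g = fst f \<longrightarrow>
        snd (\<phi> g) d = snd f d \<longrightarrow> snd g a = snd (\<psi> f) a"
      using value_detected_at_one_tuple[OF C' iso \<psi>(1)[OF f(1)], of a] \<psi>[OF f(1)] by auto
    then show "\<exists>F. finite F \<and> F \<subseteq> tuples D' (fst f) \<and> (\<forall>g\<in>C'. fst g = fst f \<longrightarrow>
        (\<forall>x\<in>F. snd g x = snd f x) \<longrightarrow> snd (\<psi> g) a = snd (\<psi> f) a)"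
      using \<psi> by (intro exI[of _ "{d}"]) auto
  qed
  ultimately have "homeomorphic_maps (subtopology (op_topology V) (Pol V E))
      (subtopology (op_topology D') C') \<phi> \<psi>"
    using \<psi>(2) \<psi>\<phi> by (auto simp: homeomorphic_maps_def)
  then show "homeomorphic_map (subtopology (op_topology V) (Pol V E))
      (subtopology (op_topology D') C') \<phi>"
    by (rule homeomorphic_maps_imp_map)
qed

end

theorem theorem52:
  fixes V :: "'v set" and E :: "'v rel"
  assumes "random_graph V E"
  shows "automatic_homeomorphicity TYPE('b) V (Pol V E)"
  using assms by (intro rado_graph.automatic_homeomorphicity_Pol rado_graph.intro)

end
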